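(* Consider a sigmoid network problem $\min_{\theta\in\mathbb{R}^n}\mathbb{L}(F(\theta))$ with the absolute or hinge loss function (see context). Let $\{\theta_k\}$ be a sequence generated by the globalized linearized proximal algorithm (GLPA) for this problem, and suppose that $\{\theta_k\}$ has a cluster point $\theta^*$. If $F'(\theta^* )$ has full row rank (i.e. rank $m$), then $\{\theta_k\}$ converges quadratically to $\theta^*$, $\theta^*$ is a globally optimal solution of $\min_{\theta\in\mathbb{R}^n}\mathbb{L}(F(\theta))$, and $F(\theta^* )\in C_{\mathbb{L}}$.
   Context: **Sigmoid network.** Let $\sigma(a)=1/(1+e^{-a})$, $d,q,m\ge1$. For parameters $\theta=(w_1,\dots,w_q,v_1,\dots,v_q,u_1,\dots,u_q,w_0)\in\mathbb{R}^n$, where $w_i,u_i,w_0\in\mathbb{R}$, $v_i\in\mathbb{R}^d$ and $n=(d+2)q+1$, set $f(x;\theta)=\sum_{i=1}^q w_i\,\sigma(v_i\cdot x+u_i)+w_0$ for $x\in\mathbb{R}^d$. Training data $(x_i,y_i)\in\mathbb{R}^d\times\mathbb{R}$, $i=1,\dots,m$, are given. **Inner and outer functions.** - Absolute loss: $F(\theta)=(f(x_i;\theta)-y_i)_{i=1}^m$, $\mathbb{L}(z)=\frac1m\|z\|_1$. - Hinge loss: $F(\theta)=(y_if(x_i;\theta))_{i=1}^m$, $\mathbb{L}(z)=\frac1m\sum_{i=1}^m\max(1-z_i,0)$. $F'(\theta)\in\mathbb{R}^{m\times n}$ is the Jacobian matrix of $F$; $C_{\mathbb{L}}=\arg\min_{z\in\mathbb{R}^m}\mathbb{L}(z)$;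 $\|\cdot\|$ is the Euclidean norm. **GLPA.** Given $t>0$, $c,\tau\in(0,1)$ and $\theta_0\in\mathbb{R}^n$, for $k=0,1,2,\dots$ let $$\Delta\theta_k=\arg\min_{\Delta\theta\in\mathbb{R}^n}\Big\{\mathbb{L}(F(\theta_k)+F'(\theta_k)\Delta\theta)+\tfrac1{2t}\|\Delta\theta\|^2\Big\}$$ (the minimizer is unique); stop if $\Delta\theta_k=0$. Otherwise let $\eta_k$ be the largest $\eta\in\{1,\tau,\tau^2,\dots\}$ such that $$\mathbb{L}(F(\theta_k+\eta\Delta\theta_k))-\mathbb{L}(F(\theta_k))\le c\,\eta\Big(\mathbb{L}(F(\theta_k)+F'(\theta_k)\Delta\theta_k)+\tfrac1{2t}\|\Delta\theta_k\|^2-\mathbb{L}(F(\theta_k))\Big),$$ and set $\theta_{k+1}=\theta_k+\eta_k\Delta\theta_k$. If the algorithm stops at iteration $k$, the sequence is regarded as constant from index $k$ on. **Rate.** $\{\theta_k\}$ converges quadratically to $\theta^*$ if $\theta_k\to\theta^*$ and there is $C>0$ with $\|\theta_{k+1}-\theta^*\|\le C\|\theta_k-\theta^*\|^2$ for all large $k$. *)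

theory Defs
  imports "HOL-Analysis.Analysis"
begin

text \<open>
  The coordinates of the parameter vector are indexed by a finite type, with one index for each
  scalar parameter: \<open>W i\<close> and \<open>U i\<close> for \<open>w\<^sub>i\<close> and \<open>u\<^sub>i\<close>, \<open>V i j\<close> for the \<open>j\<close>-th component of \<open>v\<^sub>i\<close>, and
  \<open>W0\<close> for \<open>w\<^sub>0\<close>. Thus \<open>real ^ ('q, 'd) param\<close> is the Euclidean space of dimension
  \<open>(d + 2) q + 1\<close> for \<open>q = CARD('q)\<close> and \<open>d = CARD('d)\<close>; see \<open>CARD_param\<close> below.
\<close>

datatype ('q, 'd) param = W 'q | V 'q 'd | U 'q | W0

lemma UNIV_param:
  "(UNIV :: ('q, 'd) param set) =
     range W \<union> range (\<lambda>(i, j). V i j) \<union> range U \<union> {W0}"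
proof -
  have "p \<in> range W \<union> range (\<lambda>(i, j). V i j) \<union> range U \<union> {W0}" for p :: "('q, 'd) param"
    by (cases p) auto
  then show ?thesis by blast
qed

instance param :: (finite, finite) finite
proof
  show "finite (UNIV :: ('a, 'b) param set)"
    by (simp add: UNIV_param)
qed

lemma CARD_param:
  "CARD(('q::finite, 'd::finite) param) = (CARD('d) + 2) * CARD('q) + 1"
proof -
  have "card (range (W :: 'q \<Rightarrow> ('q, 'd) param)) = CARD('q)"
       "card (range (U :: 'q \<Rightarrow> ('q, 'd) param)) = CARD('q)"
    by (auto intro!: card_image injI)
  moreover have "card (range (\<lambda>(i, j). V i j :: ('q, 'd) param)) = CARD('q) * CARD('d)"
    by (subst card_image) (auto simp: inj_on_def)
  moreover have "CARD(('q, 'd) param) =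
      card (range (W :: 'q \<Rightarrow> ('q, 'd) param)) + card (range (\<lambda>(i, j). V i j :: ('q, 'd) param))
      + card (range (U :: 'q \<Rightarrow> ('q, 'd) param)) + card {W0 :: ('q, 'd) param}"
    unfolding UNIV_param by (subst card_Un_disjoint; auto)+
  ultimately show ?thesis by (simp add: algebra_simps)
qed

definition sigmoid :: "real \<Rightarrow> real" where
  "sigmoid a = 1 / (1 + exp (- a))"

definition network :: "real ^ ('q::finite, 'd::finite) param \<Rightarrow> real ^ 'd \<Rightarrow> real" where
  "network \<theta> x =
     (\<Sum>i\<in>UNIV. \<theta> $ W i * sigmoid ((\<chi> j. \<theta> $ V i j) \<bullet> x + \<theta> $ U i)) + \<theta> $ W0"

definition abs_inner ::
  "('m::finite \<Rightarrow> real ^ 'd) \<Rightarrow> ('m \<Rightarrow> real) \<Rightarrow> real ^ ('q::finite, 'd::finite) param \<Rightarrow> real ^ 'm"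
where
  "abs_inner x y \<theta> = (\<chi> i. network \<theta> (x i) - y i)"

definition abs_outer :: "real ^ 'm::finite \<Rightarrow> real" where
  "abs_outer z = 1 / real CARD('m) * (\<Sum>i\<in>UNIV. \<bar>z $ i\<bar>)"

definition hinge_inner ::
  "('m::finite \<Rightarrow> real ^ 'd) \<Rightarrow> ('m \<Rightarrow> real) \<Rightarrow> real ^ ('q::finite, 'd::finite) param \<Rightarrow> real ^ 'm"
where
  "hinge_inner x y \<theta> = (\<chi> i. y i * network \<theta> (x i))"

definition hinge_outer :: "real ^ 'm::finite \<Rightarrow> real" where
  "hinge_outer z = 1 / real CARD('m) * (\<Sum>i\<in>UNIV. max (1 - z $ i) 0)"

abbreviation Jac :: "(real ^ 'n \<Rightarrow> real ^ 'm) \<Rightarrow> real ^ 'n \<Rightarrow> real ^ 'n ^ 'm" where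
  "Jac F \<theta> \<equiv> jacobian F (at \<theta>)"

definition argmin_set :: "('a \<Rightarrow> real) \<Rightarrow> 'a set" where
  "argmin_set g = {z. is_arg_min g (\<lambda>_. True) z}"

definition prox_model ::
  "(real ^ 'm \<Rightarrow> real) \<Rightarrow> (real ^ 'n \<Rightarrow> real ^ 'm) \<Rightarrow> real \<Rightarrow> real ^ 'n \<Rightarrow> real ^ 'n \<Rightarrow> real"
where
  "prox_model L F t \<theta> \<Delta> = L (F \<theta> + Jac F \<theta> *v \<Delta>) + 1 / (2 * t) * (norm \<Delta>)\<^sup>2"

definition sufficient_decrease ::
  "(real ^ 'm \<Rightarrow> real) \<Rightarrow> (real ^ 'n \<Rightarrow> real ^ 'm) \<Rightarrow> real \<Rightarrow> real \<Rightarrow> real ^ 'n \<Rightarrow> real ^ 'n \<Rightarrow> real \<Rightarrow> bool"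
where
  "sufficient_decrease L F t c \<theta> \<Delta> \<eta> \<longleftrightarrow>
     L (F (\<theta> + \<eta> *\<^sub>R \<Delta>)) - L (F \<theta>) \<le> c * \<eta> * (prox_model L F t \<theta> \<Delta> - L (F \<theta>))"

definition is_step_size ::
  "(real ^ 'm \<Rightarrow> real) \<Rightarrow> (real ^ 'n \<Rightarrow> real ^ 'm) \<Rightarrow> real \<Rightarrow> real \<Rightarrow> real \<Rightarrow>
     real ^ 'n \<Rightarrow> real ^ 'n \<Rightarrow> real \<Rightarrow> bool"
where
  "is_step_size L F t c \<tau> \<theta> \<Delta> \<eta> \<longleftrightarrow>
     is_arg_max id (\<lambda>s. s \<in> range (\<lambda>j::nat. \<tau> ^ j) \<and> sufficient_decrease L F t c \<theta> \<Delta> s) \<eta>"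

text \<open>
  Termination at iteration \<open>k\<close> is encoded by \<open>\<theta> (Suc k) = \<theta> k\<close>: the direction at \<open>k + 1\<close> is then
  again the (unique) minimizer \<open>0\<close>, so that the sequence is constant from \<open>k\<close> on.
\<close>

definition GLPA_sequence ::
  "(real ^ 'm \<Rightarrow> real) \<Rightarrow> (real ^ 'n \<Rightarrow> real ^ 'm) \<Rightarrow> real \<Rightarrow> real \<Rightarrow> real \<Rightarrow>
     (nat \<Rightarrow> real ^ 'n) \<Rightarrow> bool"
where
  "GLPA_sequence L F t c \<tau> \<theta> \<longleftrightarrow>
     (\<forall>k. \<exists>\<Delta>. \<Delta> \<in> argmin_set (prox_model L F t (\<theta> k)) \<and>
        (if \<Delta> = 0 then \<theta> (Suc k) = \<theta> k
         else \<exists>\<eta>. is_step_size L F t c \<tau> (\<theta> k) \<Delta> \<eta> \<and> \<theta> (Suc k) = \<theta> k + \<eta> *\<^sub>R \<Delta>))"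

definition cluster_point :: "(nat \<Rightarrow> 'a::topological_space) \<Rightarrow> 'a \<Rightarrow> bool" where
  "cluster_point X l \<longleftrightarrow> (\<exists>r. strict_mono r \<and> (X \<circ> r) \<longlonglongrightarrow> l)"

definition converges_quadratically :: "(nat \<Rightarrow> 'a::real_normed_vector) \<Rightarrow> 'a \<Rightarrow> bool" where
  "converges_quadratically X l \<longleftrightarrow>
     X \<longlonglongrightarrow> l \<and>
     (\<exists>C>0. \<forall>\<^sub>F k in sequentially. norm (X (Suc k) - l) \<le> C * (norm (X k - l))\<^sup>2)"

end

theory Submission
  imports Defs
begin

text \<open>
  Both losses are convex, Lipschitz and have minimum 0 with a sharp minimizing set: the distance to
  that set is bounded by a multiple of the loss. Since the Jacobian has full row rank near \<open>\<theta>s\<close>, the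
  linearized problem can be solved exactly by a direction of length \<open>O(L (F a))\<close>. If \<open>L (F \<theta>s)\<close> were
  positive, this would force a uniform decrease at infinitely many iterates, which is impossible;
  hence \<open>L (F \<theta>s) = 0\<close>. Near \<open>\<theta>s\<close> the same direction shows that the proximal step has length
  \<open>O(L (F a))\<close> and, taken in full, leaves a loss of \<open>O((L (F a))\<^sup>2)\<close>. The loss then shrinks so fast that
  the iterates are trapped near \<open>\<theta>s\<close>, with distance to \<open>\<theta>s\<close> comparable to the loss.
\<close>

section \<open>Sequences trapped by a decreasing gauge\<close>

text \<open>Once \<open>g\<close> halves in each step, \<open>norm (X j - X k) \<le> 2 * B * (g k - g j)\<close> for \<open>j \<ge> k\<close>; this
  telescoping invariant keeps the sequence in the ball.\<close>

lemma trapped_sequence: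
  fixes X :: "nat \<Rightarrow> 'a::real_normed_vector" and g :: "nat \<Rightarrow> real"
  assumes r: "strict_mono r" "(X \<circ> r) \<longlonglongrightarrow> l" "(g \<circ> r) \<longlonglongrightarrow> 0"
    and g_nonneg: "\<And>k. 0 \<le> g k"
    and pos: "\<delta> > 0" "\<epsilon> > 0" "A > 0" "B > 0"
    and step: "\<And>k. X k \<in> ball l \<delta> \<Longrightarrow> g k \<le> \<epsilon> \<Longrightarrow>
                 norm (X (Suc k) - X k) \<le> B * g k \<and> g (Suc k) \<le> A * (g k)\<^sup>2"
  shows "X \<longlonglongrightarrow> l \<and>
         (\<exists>C>0. \<forall>\<^sub>F k in sequentially. norm (X (Suc k) - l) \<le> C * (g k)\<^sup>2)"
proof -
  \<comment> \<open>Three caps: \<open>step\<close> applies, \<open>A * g k\<close> is at most 1/2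
    so that \<open>g\<close> halves, and the total travel \<open>2 * B * \<gamma>\<close> is at most
    half the radius.\<close>
  define \<gamma> where "\<gamma> = min \<epsilon> (min (1 / (2 * A)) (\<delta> / (4 * B)))"
  have \<gamma>: "\<gamma> > 0" "\<gamma> \<le> \<epsilon>" "\<gamma> \<le> 1 / (2 * A)" "\<gamma> \<le> \<delta> / (4 * B)"
    using pos by (auto simp: \<gamma>_def)
  have "\<forall>\<^sub>F n in sequentially. dist ((X \<circ> r) n) l < \<delta> / 2"
    using tendstoD[OF r(2)] pos half_gt_zero by blast
  moreover have "\<forall>\<^sub>F n in sequentially. (g \<circ> r) n < \<gamma>"
    using r(3) \<gamma>(1) by (rule order_tendstoD)
  ultimately have "\<forall>\<^sub>F n in sequentially. dist ((X \<circ> r) n) l < \<delta> / 2 \<and> (g \<circ> r) n < \<gamma>"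
    by eventually_elim auto
  then obtain n where n: "dist (X (r n)) l < \<delta> / 2" "g (r n) < \<gamma>"
    using eventually_happens'[OF sequentially_bot] by fastforce
  \<comment> \<open>Starting in the half-radius ball leaves the other half for the remaining
    travel.\<close>
  define k0 where "k0 = r n"
  have halve: "norm (X (Suc k) - X k) \<le> 2 * B * (g k - g (Suc k)) \<and> g (Suc k) \<le> g k \<and>
               g (Suc k) \<le> A * (g k)\<^sup>2"
    if k: "X k \<in> ball l \<delta>" "g k \<le> \<gamma>" for k
  proof -
    have st: "norm (X (Suc k) - X k) \<le> B * g k" "g (Suc k) \<le> A * (g k)\<^sup>2"
      using step k \<gamma> by force+
    have "A * g k \<le> A * (1 / (2 * A))"
      using k \<gamma> pos by (intro mult_left_mono) auto
    then have "A * g k \<le> 1 / 2" using pos by simp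
    then have "A * g k * g k \<le> 1 / 2 * g k"
      using g_nonneg by (rule mult_right_mono)
    then have h: "g (Suc k) \<le> g k / 2"
      using st by (simp add: power2_eq_square mult.assoc)
    then have "B * g k \<le> B * (2 * (g k - g (Suc k)))"
      using pos by (intro mult_left_mono) auto
    also have "\<dots> = 2 * B * (g k - g (Suc k))" by simp
    finally show ?thesis using st h g_nonneg[of k] by auto
  qed
  have inv: "X (k0 + i) \<in> ball l \<delta> \<and> g (k0 + i) \<le> \<gamma> \<and>
        norm (X (k0 + i) - X k0) \<le> 2 * B * (g k0 - g (k0 + i))" for i
  proof (induction i)
    case 0
    then show ?case using n pos by (auto simp: k0_def dist_commute)
  next
    case (Suc i)
    then have h: "norm (X (Suc (k0 + i)) - X (k0 + i)) \<le> 2 * B * (g (k0 + i) - g (Suc (k0 + i)))"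
      "g (Suc (k0 + i)) \<le> g (k0 + i)"
      using halve by auto
    have "norm (X (Suc (k0 + i)) - X k0) \<le>
        norm (X (Suc (k0 + i)) - X (k0 + i)) + norm (X (k0 + i) - X k0)"
      using norm_triangle_ineq[of "X (Suc (k0 + i)) - X (k0 + i)" "X (k0 + i) - X k0"] by simp
    also have "\<dots> \<le> 2 * B * (g k0 - g (Suc (k0 + i)))"
      using h Suc by (simp add: algebra_simps)
    finally have d: "norm (X (Suc (k0 + i)) - X k0) \<le> 2 * B * (g k0 - g (Suc (k0 + i)))" .
    also have "\<dots> \<le> 2 * B * \<gamma>"
      using n g_nonneg[of "Suc (k0 + i)"] pos by (intro mult_left_mono) (auto simp: k0_def)
    also have "\<dots> \<le> \<delta> / 2"
      using \<gamma>(4) pos by (simp add: field_simps)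
    finally have "dist l (X (Suc (k0 + i))) < \<delta>"
      using n(1) dist_triangle[of l "X (Suc (k0 + i))" "X k0"]
      unfolding k0_def dist_norm by (simp add: norm_minus_commute)
    then show ?case using d h Suc by auto
  qed
  have near: "X k \<in> ball l \<delta>" "g k \<le> \<gamma>" if "k \<ge> k0" for k
    using inv[of "k - k0"] that by auto
  have tele: "norm (X (k + i) - X k) \<le> 2 * B * (g k - g (k + i)) \<and> g (k + i) \<le> g k"
    if "k \<ge> k0" for k i
  proof (induction i)
    case (Suc i)
    have h: "norm (X (Suc (k + i)) - X (k + i)) \<le> 2 * B * (g (k + i) - g (Suc (k + i)))"
      "g (Suc (k + i)) \<le> g (k + i)"
      using halve near that by auto
    have "norm (X (Suc (k + i)) - X k) \<le>
        norm (X (Suc (k + i)) - X (k + i)) + norm (X (k + i) - X k)"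
      using norm_triangle_ineq[of "X (Suc (k + i)) - X (k + i)" "X (k + i) - X k"] by simp
    also have "\<dots> \<le> 2 * B * (g k - g (Suc (k + i)))"
      using h Suc by (simp add: algebra_simps)
    finally show ?case using h Suc by auto
  qed auto
  \<comment> \<open>The later index in \<open>tele\<close> runs along \<open>r\<close>, so
    \<open>l\<close> can be reached before full convergence is known.\<close>
  have bound: "norm (X k - l) \<le> 2 * B * g k" if k: "k \<ge> k0" for k
  proof (rule tendsto_upperbound)
    show "(\<lambda>n. norm (X k - (X \<circ> r) n)) \<longlonglongrightarrow> norm (X k - l)"
      by (intro tendsto_intros r)
    show "\<forall>\<^sub>F n in sequentially. norm (X k - (X \<circ> r) n) \<le> 2 * B * g k"
      using eventually_ge_at_top[of k]
    proof eventually_elim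
      case (elim n)
      then have "k \<le> r n" using strict_mono_imp_increasing[OF r(1)] le_trans by blast
      then have "norm (X (r n) - X k) \<le> 2 * B * (g k - g (r n))"
        using tele[OF k, of "r n - k"] by simp
      also have "\<dots> \<le> 2 * B * g k"
        using g_nonneg[of "r n"] pos by (intro mult_left_mono) auto
      finally show ?case by (simp add: norm_minus_commute)
    qed
  qed auto
  have g0: "g \<longlonglongrightarrow> 0"
  proof (rule LIMSEQ_I)
    fix e :: real assume "e > 0"
    then have "\<forall>\<^sub>F n in sequentially. (g \<circ> r) n < e"
      using r(3) by (intro order_tendstoD)
    then have "\<forall>\<^sub>F n in sequentially. (g \<circ> r) n < e \<and> k0 \<le> n"
      using eventually_ge_at_top[of k0] by eventually_elim auto
    then obtain n where n: "g (r n) < e" "k0 \<le> n"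
      using eventually_happens'[OF sequentially_bot] by fastforce
    then have "k0 \<le> r n" using strict_mono_imp_increasing[OF r(1)] le_trans by blast
    then have "g k < e" if "k \<ge> r n" for k
      using tele[of "r n" "k - r n"] n that by auto
    then show "\<exists>no. \<forall>k\<ge>no. norm (g k - 0) < e"
      using g_nonneg by auto
  qed
  have "(\<lambda>k. X k - l) \<longlonglongrightarrow> 0"
  proof (rule Lim_null_comparison)
    show "\<forall>\<^sub>F k in sequentially. norm (X k - l) \<le> 2 * B * g k"
      using bound by (auto simp: eventually_sequentially)
    show "(\<lambda>k. 2 * B * g k) \<longlonglongrightarrow> 0"
      using tendsto_mult_right_zero[OF g0] by blast
  qed
  then have "X \<longlonglongrightarrow> l" by (rule LIM_zero_cancel)
  moreover have "norm (X (Suc k) - l) \<le> (2 * B * A) * (g k)\<^sup>2" if "k \<ge> k0" for k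
  proof -
    have "norm (X (Suc k) - l) \<le> 2 * B * g (Suc k)"
      using bound that by simp
    also have "\<dots> \<le> 2 * B * (A * (g k)\<^sup>2)"
      using halve near that pos by (intro mult_left_mono) auto
    finally show ?thesis by (simp add: mult.assoc)
  qed
  then have "\<forall>\<^sub>F k in sequentially. norm (X (Suc k) - l) \<le> (2 * B * A) * (g k)\<^sup>2"
    by (auto simp: eventually_sequentially)
  moreover have "2 * B * A > 0" using pos by simp
  ultimately show ?thesis by blast
qed

section \<open>Convergence for sharp convex outer functions\<close>

text \<open>\<open>L_sharp\<close> and \<open>L_nonneg\<close> make 0 the attained minimum and the
  loss a bound for the distance to the minimizers. The free radius in \<open>F_taylor\<close> lets
  each estimate choose a ball that contains its trial points.\<close>

locale glpa =
  fixes L :: "real ^ 'm::finite \<Rightarrow> real" and F :: "real ^ 'n::finite \<Rightarrow> real ^ 'm"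
    and \<beta> \<kappa> t c \<tau> :: real and \<theta> :: "nat \<Rightarrow> real ^ 'n" and \<theta>s :: "real ^ 'n"
  assumes L_convex: "convex_on UNIV L"
    and \<beta>: "\<beta> > 0" and L_lipschitz: "\<bar>L u - L v\<bar> \<le> \<beta> * norm (u - v)"
    and L_nonneg: "0 \<le> L z"
    and \<kappa>: "\<kappa> > 0" and L_sharp: "\<exists>p. L p = 0 \<and> norm (p - z) \<le> \<kappa> * L z"
    and F_taylor: "\<exists>M>0. \<forall>a\<in>cball 0 R. \<forall>b\<in>cball 0 R.
           norm (F b - F a - Jac F a *v (b - a)) \<le> M * (norm (b - a))\<^sup>2"
    and t: "t > 0" and c: "0 < c" "c < 1" and \<tau>: "0 < \<tau>" "\<tau> < 1"
    and glpa: "GLPA_sequence L F t c \<tau> \<theta>"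
    and cluster: "cluster_point \<theta> \<theta>s"
    and full_rank: "rank (Jac F \<theta>s) = CARD('m)"
begin

text \<open>Taylor expansions at \<open>a\<close> and \<open>b\<close>, with an increment of the same length as \<open>b - a\<close>,
  show that the Jacobian inherits local Lipschitz continuity from the quadratic remainder bound.\<close>

lemma Jac_lipschitz:
  "\<exists>M>0. \<forall>b\<in>ball \<theta>s 1. \<forall>h. norm (Jac F b *v h - Jac F \<theta>s *v h) \<le> M * norm (b - \<theta>s) * norm h"
proof -
  define R where "R = norm \<theta>s + 2"
  obtain M where M: "M > 0" and rem: "\<And>a b. norm a \<le> R \<Longrightarrow> norm b \<le> R \<Longrightarrow>
      norm (F b - F a - Jac F a *v (b - a)) \<le> M * (norm (b - a))\<^sup>2"
    using F_taylor[of R] by (auto simp: mem_cball_0)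
  have same: "norm (Jac F b *v h - Jac F \<theta>s *v h) \<le> 6 * M * (norm (b - \<theta>s))\<^sup>2"
    if b: "b \<in> ball \<theta>s 1" and h: "norm h = norm (b - \<theta>s)" for b h
  proof -
    define e where "e = norm (b - \<theta>s)"
    have e: "e < 1" "e \<ge> 0" using b by (auto simp: e_def dist_norm norm_minus_commute)
    have nb: "norm b \<le> norm \<theta>s + 1"
      using e norm_triangle_ineq[of "\<theta>s" "b - \<theta>s"] by (simp add: e_def)
    have nbh: "norm (b + h) \<le> R"
      using nb e h norm_triangle_ineq[of b h] by (simp add: R_def e_def)
    have bR: "norm b \<le> R" "norm \<theta>s \<le> R" using nb by (auto simp: R_def)
    define p1 p2 p3 where "p1 = F (b + h) - F b - Jac F b *v (b + h - b)"
      and "p2 = F (b + h) - F \<theta>s - Jac F \<theta>s *v (b + h - \<theta>s)"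
      and "p3 = F b - F \<theta>s - Jac F \<theta>s *v (b - \<theta>s)"
    have 1: "norm p1 \<le> M * e\<^sup>2"
      using rem[OF bR(1) nbh] h by (simp add: p1_def e_def)
    have "norm (b + h - \<theta>s) \<le> 2 * e"
      using norm_triangle_ineq[of "b - \<theta>s" h] h by (simp add: e_def algebra_simps)
    then have "(norm (b + h - \<theta>s))\<^sup>2 \<le> (2 * e)\<^sup>2" by (rule power_mono) auto
    then have "M * (norm (b + h - \<theta>s))\<^sup>2 \<le> M * (4 * e\<^sup>2)"
      using M by (intro mult_left_mono) (auto simp: power_mult_distrib)
    then have 2: "norm p2 \<le> M * (4 * e\<^sup>2)"
      using rem[OF bR(2) nbh] unfolding p2_def by linarith
    have 3: "norm p3 \<le> M * e\<^sup>2"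
      using rem[OF bR(2) bR(1)] by (simp add: p3_def e_def)
    \<comment> \<open>All values of \<open>F\<close> cancel, leaving three remainders whose
      constants 4, 1 and 1 add up to 6.\<close>
    have "Jac F b *v h - Jac F \<theta>s *v h = p2 - p3 - p1"
      by (simp add: p1_def p2_def p3_def matrix_vector_mult_diff_distrib matrix_vector_right_distrib)
    also have "norm (p2 - p3 - p1) \<le> norm p2 + norm p3 + norm p1"
      by (meson norm_triangle_ineq4 add_right_mono order_trans)
    also have "\<dots> \<le> 6 * M * e\<^sup>2" using 1 2 3 by simp
    finally show ?thesis by (simp add: e_def)
  qed
  have "norm (Jac F b *v h - Jac F \<theta>s *v h) \<le> 6 * M * norm (b - \<theta>s) * norm h"
    if b: "b \<in> ball \<theta>s 1" for b h
  proof (cases "h = 0 \<or> b = \<theta>s")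
    case False
    \<comment> \<open>Rescaling gives \<open>h\<close> the length required by \<open>same\<close>;
      linearity scales the bound back.\<close>
    define s where "s = norm (b - \<theta>s) / norm h"
    have s: "s > 0" using False by (simp add: s_def)
    have "s * norm (Jac F b *v h - Jac F \<theta>s *v h)
        = norm (Jac F b *v (s *\<^sub>R h) - Jac F \<theta>s *v (s *\<^sub>R h))"
      using s by (simp add: matrix_vector_mult_scaleR flip: scaleR_diff_right)
    also have "\<dots> \<le> 6 * M * (norm (b - \<theta>s))\<^sup>2"
      using False s by (intro same b) (simp add: s_def)
    also have "\<dots> = s * (6 * M * norm (b - \<theta>s) * norm h)"
      using False by (simp add: s_def power2_eq_square)
    finally show ?thesis using s by simp
  qed auto
  then show ?thesis using M by (intro exI[of _ "6 * M"]) auto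
qed

text \<open>With a right inverse \<open>S\<close> of the Jacobian at \<open>\<theta>s\<close>, the square matrix \<open>Jac F a ** S\<close> is a small
  perturbation of the identity for \<open>a\<close> near \<open>\<theta>s\<close>, hence invertible with inverse of norm at most 2.\<close>

lemma Jac_solvable:
  "\<exists>\<delta>>0. \<exists>K>0. \<forall>a\<in>ball \<theta>s \<delta>. \<forall>w. \<exists>h. Jac F a *v h = w \<and> norm h \<le> K * norm w"
proof -
  obtain M where M: "M > 0" and lip: "\<And>b h. b \<in> ball \<theta>s 1 \<Longrightarrow>
      norm (Jac F b *v h - Jac F \<theta>s *v h) \<le> M * norm (b - \<theta>s) * norm h"
    using Jac_lipschitz by blast
  have "surj ((*v) (Jac F \<theta>s))"
    using full_rank by (simp add: full_rank_surjective)
  then obtain S where S: "Jac F \<theta>s ** S = mat 1"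
    using matrix_right_invertible_surjective by blast
  have "linear ((*v) S)" by simp
  then obtain K where K: "K > 0" "\<And>v. norm (S *v v) \<le> K * norm v"
    using linear_bounded_pos by blast
  \<comment> \<open>The cap 1 makes \<open>lip\<close> applicable; the other keeps
    \<open>G v - v\<close> at most half as long as \<open>v\<close>.\<close>
  define \<delta> where "\<delta> = min 1 (1 / (2 * M * K))"
  have \<delta>: "\<delta> > 0" using M K by (simp add: \<delta>_def)
  have "\<exists>h. Jac F a *v h = w \<and> norm h \<le> (2 * K) * norm w" if a: "a \<in> ball \<theta>s \<delta>" for a w
  proof -
    define G where "G v = Jac F a *v (S *v v)" for v
    have lin: "linear G"
      unfolding G_def
      using linear_compose[OF matrix_vector_mul_linear[of S] matrix_vector_mul_linear[of "Jac F a"]]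
      by (simp add: o_def)
    have G: "norm v \<le> 2 * norm (G v)" for v
    proof -
      have "Jac F \<theta>s *v (S *v v) = v"
        by (simp add: matrix_vector_mul_assoc S)
      then have "norm (G v - v) \<le> M * norm (a - \<theta>s) * norm (S *v v)"
        using lip[of a "S *v v"] a by (simp add: G_def \<delta>_def)
      also have "\<dots> \<le> M * (1 / (2 * M * K)) * (K * norm v)"
        using M K(1) a K(2)[of v]
        by (intro mult_mono) (auto simp: \<delta>_def dist_norm norm_minus_commute)
      also have "\<dots> = norm v / 2" using M K by simp
      finally show ?thesis
        using norm_triangle_ineq2[of v "v - G v"] by (simp add: norm_minus_commute)
    qed
    have "inj G"
      unfolding linear_injective_0[OF lin] using G by (metis mult_zero_right norm_le_zero_iff norm_zero)
    then have "surj G" using linear_injective_imp_surjective[OF lin] by simp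
    then obtain v where v: "G v = w" by (metis surjD)
    have "norm (S *v v) \<le> K * norm v" by (rule K)
    also have "\<dots> \<le> K * (2 * norm w)" using K G[of v] v by (intro mult_left_mono) auto
    finally show ?thesis using v by (intro exI[of _ "S *v v"]) (simp add: G_def)
  qed
  then show ?thesis using \<delta> K by (intro exI[of _ \<delta>] conjI exI[of _ "2 * K"]) auto
qed

section \<open>Convexity, line search and monotone descent\<close>

lemma L_segment: "L (u + s *\<^sub>R v) \<le> (1 - s) * L u + s * L (u + v)" if "0 \<le> s" "s \<le> 1"
proof -
  have "L ((1 - s) *\<^sub>R u + s *\<^sub>R (u + v)) \<le> (1 - s) * L u + s * L (u + v)"
    using that by (intro convex_onD[OF L_convex]) auto
  then show ?thesis by (simp add: algebra_simps)
qed

text \<open>Convexity bounds \<open>L\<close> along the linearization, and the Lipschitz bound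
  transfers this to \<open>F\<close> at the cost of a term quadratic in the step. Comparing that
  term with the model decrease gives acceptance of a uniform short step far from optimality and of
  the full step near it.\<close>

lemma line_search_bound:
  assumes rem: "norm (F (a + \<eta> *\<^sub>R d) - F a - Jac F a *v (\<eta> *\<^sub>R d)) \<le> M * (norm (\<eta> *\<^sub>R d))\<^sup>2"
    and \<eta>: "0 \<le> \<eta>" "\<eta> \<le> 1"
  shows "L (F (a + \<eta> *\<^sub>R d)) \<le>
    (1 - \<eta>) * L (F a) + \<eta> * L (F a + Jac F a *v d) + \<beta> * M * \<eta>\<^sup>2 * (norm d)\<^sup>2"
proof -
  have "L (F (a + \<eta> *\<^sub>R d)) - L (F a + \<eta> *\<^sub>R (Jac F a *v d))
      \<le> \<beta> * norm (F (a + \<eta> *\<^sub>R d) - (F a + \<eta> *\<^sub>R (Jac F a *v d)))"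
    using L_lipschitz[of "F (a + \<eta> *\<^sub>R d)" "F a + \<eta> *\<^sub>R (Jac F a *v d)"] by linarith
  also have "\<dots> \<le> \<beta> * (M * (norm (\<eta> *\<^sub>R d))\<^sup>2)"
    using rem \<beta> by (intro mult_left_mono) (auto simp: matrix_vector_mult_scaleR diff_diff_add)
  finally show ?thesis
    using L_segment[OF \<eta>, of "F a" "Jac F a *v d"] by (simp add: power_mult_distrib algebra_simps)
qed

text \<open>One form for all iterations, stopped ones included, so that later arguments need no case
  distinction on the direction.\<close>

lemma step:
  obtains d \<eta> where "\<And>e. prox_model L F t (\<theta> k) d \<le> prox_model L F t (\<theta> k) e"
    "\<theta> (Suc k) = \<theta> k + \<eta> *\<^sub>R d" "0 < \<eta>" "\<eta> \<le> 1"
    "sufficient_decrease L F t c (\<theta> k) d \<eta>"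
    "\<And>j. sufficient_decrease L F t c (\<theta> k) d (\<tau> ^ j) \<Longrightarrow> \<tau> ^ j \<le> \<eta>"
proof -
  obtain d where d: "d \<in> argmin_set (prox_model L F t (\<theta> k))"
    and next_d: "if d = 0 then \<theta> (Suc k) = \<theta> k
         else \<exists>\<eta>. is_step_size L F t c \<tau> (\<theta> k) d \<eta> \<and> \<theta> (Suc k) = \<theta> k + \<eta> *\<^sub>R d"
    using glpa unfolding GLPA_sequence_def by blast
  have min: "\<And>e. prox_model L F t (\<theta> k) d \<le> prox_model L F t (\<theta> k) e"
    using d by (auto simp: argmin_set_def is_arg_min_def not_less)
  show thesis
  proof (cases "d = 0")
    case True
    \<comment> \<open>For a zero direction both sides of the decrease test vanish; 1 is accepted and
      no power of \<open>\<tau>\<close> exceeds it.\<close>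
    show thesis
      by (rule that[of d 1])
        (use min True next_d \<tau> in \<open>auto simp: sufficient_decrease_def prox_model_def power_le_one\<close>)
  next
    case False
    then obtain \<eta> where \<eta>: "is_step_size L F t c \<tau> (\<theta> k) d \<eta>" "\<theta> (Suc k) = \<theta> k + \<eta> *\<^sub>R d"
      using next_d by auto
    show thesis
      by (rule that[of d \<eta>])
        (use min \<eta> \<tau> in \<open>auto simp: is_step_size_def is_arg_max_def power_le_one not_less\<close>)
  qed
qed

lemma prox_min_le:
  assumes "\<And>e. prox_model L F t a d \<le> prox_model L F t a e"
  shows "prox_model L F t a d \<le> L (F a)"
  using assms[of 0] by (simp add: prox_model_def)

lemma LF_decreasing: "L (F (\<theta> (Suc k))) \<le> L (F (\<theta> k))"
proof -
  obtain d \<eta> where d: "\<And>e. prox_model L F t (\<theta> k) d \<le> prox_model L F t (\<theta> k) e"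
    and \<eta>: "\<theta> (Suc k) = \<theta> k + \<eta> *\<^sub>R d" "0 < \<eta>" "sufficient_decrease L F t c (\<theta> k) d \<eta>"
    using step[of k] by metis
  have "c * \<eta> * (prox_model L F t (\<theta> k) d - L (F (\<theta> k))) \<le> 0"
    using prox_min_le[OF d] c \<eta>(2) by (intro mult_nonneg_nonpos) auto
  then show ?thesis using \<eta> by (auto simp: sufficient_decrease_def)
qed

lemma LF_antimono: "j \<le> k \<Longrightarrow> L (F (\<theta> k)) \<le> L (F (\<theta> j))"
  using LF_decreasing by (rule lift_Suc_antimono_le)

text \<open>Within distance 1 the quadratic remainder is dominated by a linear one. The estimate
  gives continuity at \<open>\<theta>s\<close> and later turns a rate in the loss into a rate in the
  distance.\<close>

lemma LF_lipschitz_at: "\<exists>C>0. \<forall>b\<in>ball \<theta>s 1. \<bar>L (F b) - L (F \<theta>s)\<bar> \<le> C * norm (b - \<theta>s)"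
proof -
  obtain M where M: "M > 0" and rem: "\<And>a b. norm a \<le> norm \<theta>s + 1 \<Longrightarrow> norm b \<le> norm \<theta>s + 1 \<Longrightarrow>
      norm (F b - F a - Jac F a *v (b - a)) \<le> M * (norm (b - a))\<^sup>2"
    using F_taylor[of "norm \<theta>s + 1"] by (auto simp: mem_cball_0)
  have "linear ((*v) (Jac F \<theta>s))" by simp
  then obtain K where K: "K > 0" "\<And>v. norm (Jac F \<theta>s *v v) \<le> K * norm v"
    using linear_bounded_pos by blast
  have "\<bar>L (F b) - L (F \<theta>s)\<bar> \<le> (\<beta> * (M + K)) * norm (b - \<theta>s)" if "b \<in> ball \<theta>s 1" for b
  proof -
    have b: "norm (b - \<theta>s) \<le> 1" using that by (simp add: dist_norm norm_minus_commute)
    then have "norm b \<le> norm \<theta>s + 1"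
      using norm_triangle_ineq[of "\<theta>s" "b - \<theta>s"] by simp
    then have "norm (F b - F \<theta>s - Jac F \<theta>s *v (b - \<theta>s)) \<le> M * (norm (b - \<theta>s))\<^sup>2"
      by (intro rem) auto
    also have "\<dots> \<le> M * norm (b - \<theta>s)"
      using b M by (intro mult_left_mono) (auto simp: power2_eq_square mult_left_le)
    finally have "norm (F b - F \<theta>s) \<le> (M + K) * norm (b - \<theta>s)"
      using norm_triangle_ineq[of "F b - F \<theta>s - Jac F \<theta>s *v (b - \<theta>s)" "Jac F \<theta>s *v (b - \<theta>s)"]
        K(2)[of "b - \<theta>s"] by (simp add: algebra_simps)
    then have "\<beta> * norm (F b - F \<theta>s) \<le> \<beta> * ((M + K) * norm (b - \<theta>s))"
      using \<beta> by (intro mult_left_mono) auto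
    then show ?thesis using L_lipschitz[of "F b" "F \<theta>s"] by (simp add: mult.assoc)
  qed
  then show ?thesis using \<beta> M K by (intro exI[of _ "\<beta> * (M + K)"]) auto
qed

lemma LF_tendsto: "(X \<longlongrightarrow> \<theta>s) net \<Longrightarrow> ((\<lambda>n. L (F (X n))) \<longlongrightarrow> L (F \<theta>s)) net"
proof -
  obtain C where C: "C > 0" "\<And>b. b \<in> ball \<theta>s 1 \<Longrightarrow> \<bar>L (F b) - L (F \<theta>s)\<bar> \<le> C * norm (b - \<theta>s)"
    using LF_lipschitz_at by blast
  assume X: "(X \<longlongrightarrow> \<theta>s) net"
  have "((\<lambda>n. L (F (X n)) - L (F \<theta>s)) \<longlongrightarrow> 0) net"
  proof (rule tendsto_0_le[where K = C])
    show "((\<lambda>n. X n - \<theta>s) \<longlongrightarrow> 0) net" using X by (rule LIM_zero)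
    show "\<forall>\<^sub>F n in net. norm (L (F (X n)) - L (F \<theta>s)) \<le> norm (X n - \<theta>s) * C"
      using tendstoD[OF X, of 1, simplified]
      by eventually_elim (use C in \<open>auto simp: dist_commute mult.commute\<close>)
  qed
  then show ?thesis by (rule LIM_zero_cancel)
qed

lemma cluster_seq:
  obtains r where "strict_mono r" "(\<theta> \<circ> r) \<longlonglongrightarrow> \<theta>s" "(\<lambda>n. L (F (\<theta> (r n)))) \<longlonglongrightarrow> L (F \<theta>s)"
proof -
  obtain r where r: "strict_mono r" "(\<theta> \<circ> r) \<longlonglongrightarrow> \<theta>s"
    using cluster by (auto simp: cluster_point_def)
  with LF_tendsto[OF r(2)] show thesis by (intro that) (auto simp: o_def)
qed

text \<open>Monotonicity puts the values along the subsequence eventually below each fixed value,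
  and their limit inherits this.\<close>

lemma LF_cluster_le: "L (F \<theta>s) \<le> L (F (\<theta> k))"
proof -
  obtain r where r: "strict_mono r" "(\<lambda>n. L (F (\<theta> (r n)))) \<longlonglongrightarrow> L (F \<theta>s)"
    using cluster_seq by metis
  show ?thesis
  proof (rule tendsto_upperbound[OF r(2)])
    show "\<forall>\<^sub>F n in sequentially. L (F (\<theta> (r n))) \<le> L (F (\<theta> k))"
      using eventually_ge_at_top[of k]
      by eventually_elim (meson LF_antimono strict_mono_imp_increasing[OF r(1)] le_trans)
  qed auto
qed

text \<open>Dropping the nonnegative loss term of the model leaves the quadratic one, so upper
  bounds on the model value control the step length.\<close>

lemma norm_prox_min:
  assumes "\<And>e. prox_model L F t a d \<le> prox_model L F t a e"
  shows "(norm d)\<^sup>2 \<le> 2 * t * prox_model L F t a d"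
  using L_nonneg[of "F a + Jac F a *v d"] t by (simp add: prox_model_def field_simps)

text \<open>If the value at \<open>\<theta>s\<close> were positive, every iterate near \<open>\<theta>s\<close> would decrease the objective by a
  fixed amount, because the Gauss--Newton direction towards a minimizer of \<open>L\<close> is available with
  bounded length.\<close>

lemma LF_cluster_zero: "L (F \<theta>s) = 0"
proof (rule ccontr)
  define l where "l = L (F \<theta>s)"
  define l0 where "l0 = L (F (\<theta> 0))"
  assume "L (F \<theta>s) \<noteq> 0"
  then have l: "l > 0" using L_nonneg[of "F \<theta>s"] by (simp add: l_def)
  have l0: "l0 > 0" using l LF_cluster_le[of 0] by (simp add: l_def l0_def)
  obtain \<delta> K where \<delta>: "\<delta> > 0" and K: "K > 0"
    and solve: "\<And>a w. a \<in> ball \<theta>s \<delta> \<Longrightarrow> \<exists>h. Jac F a *v h = w \<and> norm h \<le> K * norm w"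
    using Jac_solvable by blast
  \<comment> \<open>The root bounds every direction, by \<open>norm_prox_min\<close> and because the
    model value never exceeds \<open>l0\<close>; so trial points from
    \<open>ball \<theta>s \<delta>\<close> stay within this radius.\<close>
  define R where "R = norm \<theta>s + \<delta> + sqrt (2 * t * l0)"
  obtain M where M: "M > 0" and rem: "\<And>a b. norm a \<le> R \<Longrightarrow> norm b \<le> R \<Longrightarrow>
      norm (F b - F a - Jac F a *v (b - a)) \<le> M * (norm (b - a))\<^sup>2"
    using F_taylor[of R] by (auto simp: mem_cball_0)
  \<comment> \<open>An exact solution \<open>h\<close> of the linearized equation is followed only
    for the fraction \<open>s\<close>, chosen so that the proximal term costs at most half of the
    gain \<open>s * L (F a)\<close>.\<close>
  define s where "s = min 1 (t / ((K * \<kappa>)\<^sup>2 * l0))"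
  have s: "0 < s" "s \<le> 1" "s * (K * \<kappa>)\<^sup>2 * l0 \<le> t"
  proof -
    have "(K * \<kappa>)\<^sup>2 * l0 > 0" using K \<kappa> l0 by simp
    then show "0 < s" "s \<le> 1" "s * (K * \<kappa>)\<^sup>2 * l0 \<le> t"
      using t by (auto simp: s_def min_def field_simps)
  qed
  define \<epsilon> where "\<epsilon> = s * l / 2"
  have \<epsilon>: "\<epsilon> > 0" using s l by (simp add: \<epsilon>_def)
  \<comment> \<open>Below this step size the quadratic term of \<open>line_search_bound\<close> is
    at most \<open>(1 - c) * \<epsilon>\<close> times the step, the slack left by the decrease
    test.\<close>
  define \<rho> where "\<rho> = (1 - c) * \<epsilon> / (\<beta> * M * (2 * t * l0))"
  have \<rho>: "\<rho> > 0" using c \<epsilon> \<beta> M t l0 by (simp add: \<rho>_def)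
  \<comment> \<open>\<open>j\<close> is fixed before the iterate, so \<open>\<tau> ^ j\<close> is a
    lower bound for the accepted step at all iterates in the ball.\<close>
  obtain j where j: "\<tau> ^ j < \<rho>"
    using real_arch_pow_inv[OF \<rho> \<tau>(2)] by blast
  have drop: "L (F (\<theta> (Suc k))) \<le> L (F (\<theta> k)) - c * \<tau> ^ j * \<epsilon>" if k: "\<theta> k \<in> ball \<theta>s \<delta>" for k
  proof -
    define a where "a = \<theta> k"
    have la: "l \<le> L (F a)" "L (F a) \<le> l0"
      using LF_cluster_le LF_antimono[of 0 k] by (auto simp: l_def l0_def a_def)
    obtain d \<eta> where d: "\<And>e. prox_model L F t a d \<le> prox_model L F t a e"
      and \<eta>: "\<theta> (Suc k) = a + \<eta> *\<^sub>R d" "0 < \<eta>" "sufficient_decrease L F t c a d \<eta>"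
        "sufficient_decrease L F t c a d (\<tau> ^ j) \<Longrightarrow> \<tau> ^ j \<le> \<eta>"
      using step[of k] unfolding a_def by metis
    define v where "v = prox_model L F t a d"
    obtain p where p: "L p = 0" "norm (p - F a) \<le> \<kappa> * L (F a)"
      using L_sharp by blast
    obtain h where h: "Jac F a *v h = p - F a" "norm h \<le> K * norm (p - F a)"
      using solve k unfolding a_def by blast
    have "norm h \<le> K * (\<kappa> * L (F a))"
      using h(2) p(2) K by (meson mult_left_mono less_imp_le order_trans)
    then have "(norm h)\<^sup>2 \<le> (K * (\<kappa> * L (F a)))\<^sup>2"
      by (intro power_mono) auto
    then have nh: "(norm h)\<^sup>2 \<le> (K * \<kappa>)\<^sup>2 * (L (F a))\<^sup>2"
      by (simp add: power_mult_distrib mult.assoc)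
    have "v \<le> prox_model L F t a (s *\<^sub>R h)"
      using d by (simp add: v_def)
    also have "\<dots> \<le> (1 - s) * L (F a) + 1 / (2 * t) * (s\<^sup>2 * (norm h)\<^sup>2)"
      using L_segment[of s "F a" "p - F a"] s p h(1)
      by (simp add: prox_model_def matrix_vector_mult_scaleR power_mult_distrib)
    also have "1 / (2 * t) * (s\<^sup>2 * (norm h)\<^sup>2) \<le> 1 / (2 * t) * (s\<^sup>2 * ((K * \<kappa>)\<^sup>2 * (L (F a))\<^sup>2))"
      using nh t by (intro mult_left_mono) auto
    also have "\<dots> = (s * (K * \<kappa>)\<^sup>2 * L (F a)) * (s * L (F a) / (2 * t))"
      by (simp add: power2_eq_square)
    also have "\<dots> \<le> t * (s * L (F a) / (2 * t))"
    proof (rule mult_right_mono)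
      have "s * (K * \<kappa>)\<^sup>2 * L (F a) \<le> s * (K * \<kappa>)\<^sup>2 * l0"
        using la s by (intro mult_left_mono) auto
      then show "s * (K * \<kappa>)\<^sup>2 * L (F a) \<le> t" using s by linarith
      show "0 \<le> s * L (F a) / (2 * t)" using s t L_nonneg[of "F a"] by simp
    qed
    finally have "v \<le> L (F a) - s * L (F a) / 2"
      using t by (simp add: algebra_simps)
    moreover have "s * l \<le> s * L (F a)" using s la by simp
    ultimately have v: "v - L (F a) \<le> - \<epsilon>" by (simp add: \<epsilon>_def)
    have "(norm d)\<^sup>2 \<le> 2 * t * v" using norm_prox_min[OF d] by (simp add: v_def)
    also have "\<dots> \<le> 2 * t * l0" using v \<epsilon> la t by (intro mult_left_mono) auto
    finally have nd: "(norm d)\<^sup>2 \<le> 2 * t * l0" .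
    have na: "norm a \<le> norm \<theta>s + \<delta>"
      using k norm_triangle_ineq[of "\<theta>s" "a - \<theta>s"] by (simp add: a_def dist_norm norm_minus_commute)
    define \<mu> where "\<mu> = \<tau> ^ j"
    have \<mu>: "0 < \<mu>" "\<mu> \<le> 1" "\<mu> < \<rho>" using \<tau> j by (auto simp: \<mu>_def power_le_one)
    have "norm (\<mu> *\<^sub>R d) \<le> norm d" using \<mu> by (simp add: mult_left_le_one_le)
    also have "\<dots> \<le> sqrt (2 * t * l0)" using nd by (rule real_le_rsqrt)
    finally have "norm (a + \<mu> *\<^sub>R d) \<le> R"
      using na norm_triangle_ineq[of a "\<mu> *\<^sub>R d"] by (simp add: R_def)
    moreover have "norm a \<le> R" using na t l0 by (simp add: R_def add_increasing2)
    ultimately have "norm (F (a + \<mu> *\<^sub>R d) - F a - Jac F a *v (\<mu> *\<^sub>R d)) \<le> M * (norm (\<mu> *\<^sub>R d))\<^sup>2"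
      using rem[of a "a + \<mu> *\<^sub>R d"] by simp
    then have "L (F (a + \<mu> *\<^sub>R d)) \<le>
        (1 - \<mu>) * L (F a) + \<mu> * L (F a + Jac F a *v d) + \<beta> * M * \<mu>\<^sup>2 * (norm d)\<^sup>2"
      using \<mu> by (intro line_search_bound) auto
    moreover have "\<mu> * L (F a + Jac F a *v d) \<le> \<mu> * v"
      using \<mu> t by (intro mult_left_mono) (auto simp: v_def prox_model_def)
    moreover have "\<beta> * M * \<mu>\<^sup>2 * (norm d)\<^sup>2 \<le> \<mu> * ((1 - c) * \<epsilon>)"
    proof -
      have "\<beta> * M * \<mu>\<^sup>2 * (norm d)\<^sup>2 \<le> \<beta> * M * \<mu>\<^sup>2 * (2 * t * l0)"
        using nd \<beta> M by (intro mult_left_mono) auto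
      also have "\<dots> = \<mu> * (\<mu> * (\<beta> * M * (2 * t * l0)))"
        by (simp add: power2_eq_square)
      also have "\<dots> \<le> \<mu> * ((1 - c) * \<epsilon>)"
        using \<mu> \<beta> M t l0 by (intro mult_left_mono) (auto simp: \<rho>_def pos_less_divide_eq)
      finally show ?thesis .
    qed
    moreover have "\<mu> * ((1 - c) * \<epsilon>) \<le> \<mu> * ((1 - c) * (L (F a) - v))"
      using v \<mu> c by (intro mult_left_mono) auto
    ultimately have "L (F (a + \<mu> *\<^sub>R d)) \<le> L (F a) + c * \<mu> * (v - L (F a))"
      by (simp add: algebra_simps)
    then have "sufficient_decrease L F t c a d \<mu>"
      by (simp add: sufficient_decrease_def v_def)
    then have "\<mu> \<le> \<eta>" using \<eta>(4) by (simp add: \<mu>_def)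
    then have "c * \<mu> * \<epsilon> \<le> c * \<eta> * \<epsilon>" using c \<epsilon> by simp
    also have "\<dots> \<le> c * \<eta> * (L (F a) - v)"
      using v c \<eta>(2) by (intro mult_left_mono) auto
    finally show ?thesis
      using \<eta>(1,3) by (simp add: sufficient_decrease_def v_def a_def \<mu>_def algebra_simps)
  qed
  obtain r where r: "(\<theta> \<circ> r) \<longlonglongrightarrow> \<theta>s" "(\<lambda>n. L (F (\<theta> (r n)))) \<longlonglongrightarrow> l"
    using cluster_seq unfolding l_def by metis
  \<comment> \<open>Far along \<open>r\<close> the value exceeds \<open>l\<close> by less than one
    drop, so the next value would fall below \<open>l\<close>, against
    \<open>LF_cluster_le\<close>.\<close>
  have gap: "c * \<tau> ^ j * \<epsilon> > 0" using c \<tau> \<epsilon> by simp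
  have "\<forall>\<^sub>F n in sequentially. L (F (\<theta> (r n))) < l + c * \<tau> ^ j * \<epsilon>"
    using gap by (intro order_tendstoD(2)[OF r(2)]) auto
  moreover have "\<forall>\<^sub>F n in sequentially. dist ((\<theta> \<circ> r) n) \<theta>s < \<delta>"
    using r(1) \<delta> by (rule tendstoD)
  ultimately have "\<forall>\<^sub>F n in sequentially. False"
  proof eventually_elim
    case (elim n)
    then show False
      using drop[of "r n"] LF_cluster_le[of "Suc (r n)"] by (simp add: l_def dist_commute)
  qed
  then show False by simp
qed

text \<open>Near \<open>\<theta>s\<close> the full step passes the line search, since the model value is quadratically small
  while the objective itself is linear in the distance from \<open>F\<close> to the minimizers of \<open>L\<close>.\<close>

lemma local_step:
  "\<exists>\<delta>>0. \<exists>\<epsilon>>0. \<exists>A>0. \<exists>B>0. \<forall>k. \<theta> k \<in> ball \<theta>s \<delta> \<longrightarrow> L (F (\<theta> k)) \<le> \<epsilon> \<longrightarrow>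
     norm (\<theta> (Suc k) - \<theta> k) \<le> B * L (F (\<theta> k)) \<and> L (F (\<theta> (Suc k))) \<le> A * (L (F (\<theta> k)))\<^sup>2"
proof -
  obtain \<delta> K where \<delta>: "\<delta> > 0" and K: "K > 0"
    and solve: "\<And>a w. a \<in> ball \<theta>s \<delta> \<Longrightarrow> \<exists>h. Jac F a *v h = w \<and> norm h \<le> K * norm w"
    using Jac_solvable by blast
  define B where "B = K * \<kappa>"
  have B: "B > 0" using K \<kappa> by (simp add: B_def)
  define R where "R = norm \<theta>s + \<delta> + B"
  obtain M where M: "M > 0" and rem: "\<And>a b. norm a \<le> R \<Longrightarrow> norm b \<le> R \<Longrightarrow>
      norm (F b - F a - Jac F a *v (b - a)) \<le> M * (norm (b - a))\<^sup>2"
    using F_taylor[of R] by (auto simp: mem_cball_0)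
  \<comment> \<open>Relative to the squared loss, the first summand bounds the model value and the
    second the Taylor remainder of the full step.\<close>
  define A where "A = B\<^sup>2 / (2 * t) + \<beta> * M * B\<^sup>2"
  have A: "A > 0" using B t \<beta> M by (simp add: A_def add_pos_pos)
  \<comment> \<open>The cap 1 keeps the direction within length \<open>B\<close>; the other makes
    \<open>A * l\<close> at most \<open>1 - c\<close>, as the test for the full step
    demands.\<close>
  define \<epsilon> where "\<epsilon> = min 1 ((1 - c) / A)"
  have \<epsilon>: "\<epsilon> > 0" using A c by (simp add: \<epsilon>_def)
  have "norm (\<theta> (Suc k) - \<theta> k) \<le> B * L (F (\<theta> k)) \<and> L (F (\<theta> (Suc k))) \<le> A * (L (F (\<theta> k)))\<^sup>2"
    if k: "\<theta> k \<in> ball \<theta>s \<delta>" "L (F (\<theta> k)) \<le> \<epsilon>" for k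
  proof -
    define a where "a = \<theta> k"
    define l where "l = L (F a)"
    have l: "0 \<le> l" "l \<le> 1" "A * l \<le> 1 - c"
      using k L_nonneg A by (auto simp: l_def a_def \<epsilon>_def pos_le_divide_eq mult.commute)
    obtain d \<eta> where d: "\<And>e. prox_model L F t a d \<le> prox_model L F t a e"
      and \<eta>: "\<theta> (Suc k) = a + \<eta> *\<^sub>R d" "\<eta> \<le> 1"
        "sufficient_decrease L F t c a d (\<tau> ^ 0) \<Longrightarrow> \<tau> ^ 0 \<le> \<eta>"
      using step[of k] unfolding a_def by metis
    define v where "v = prox_model L F t a d"
    obtain p where p: "L p = 0" "norm (p - F a) \<le> \<kappa> * L (F a)"
      using L_sharp by blast
    obtain h where h: "Jac F a *v h = p - F a" "norm h \<le> K * norm (p - F a)"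
      using solve k unfolding a_def by blast
    have "norm h \<le> K * (\<kappa> * L (F a))"
      using h(2) p(2) K by (meson mult_left_mono less_imp_le order_trans)
    then have "(norm h)\<^sup>2 \<le> (B * l)\<^sup>2"
      by (intro power_mono) (auto simp: B_def l_def mult.assoc)
    \<comment> \<open>The loss term of the model vanishes at \<open>h\<close>, since the
      linearization there equals \<open>p\<close>.\<close>
    moreover have "v \<le> 1 / (2 * t) * (norm h)\<^sup>2"
      using d[of h] p h(1) by (simp add: v_def prox_model_def)
    ultimately have v: "2 * t * v \<le> (B * l)\<^sup>2"
      using t by (simp add: field_simps)
    have "(norm d)\<^sup>2 \<le> (B * l)\<^sup>2"
      using norm_prox_min[OF d] v by (simp add: v_def)
    then have nd: "norm d \<le> B * l"
      using B l by (auto intro: power2_le_imp_le)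
    have na: "norm a \<le> norm \<theta>s + \<delta>"
      using k norm_triangle_ineq[of "\<theta>s" "a - \<theta>s"] by (simp add: a_def dist_norm norm_minus_commute)
    have "B * l \<le> B" using B l by (simp add: mult_left_le)
    then have "norm (a + d) \<le> R" "norm a \<le> R"
      using na nd B norm_triangle_ineq[of a d] unfolding R_def by linarith+
    then have "norm (F (a + 1 *\<^sub>R d) - F a - Jac F a *v (1 *\<^sub>R d)) \<le> M * (norm (1 *\<^sub>R d))\<^sup>2"
      using rem[of a "a + d"] by simp
    then have "L (F (a + d)) \<le> L (F a + Jac F a *v d) + \<beta> * M * (norm d)\<^sup>2"
      using line_search_bound[of a 1 d M] by simp
    also have "\<dots> \<le> v + \<beta> * M * (B * l)\<^sup>2"
      using t \<beta> M \<open>(norm d)\<^sup>2 \<le> (B * l)\<^sup>2\<close>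
      by (intro add_mono mult_left_mono) (auto simp: v_def prox_model_def)
    also have "\<dots> \<le> A * l\<^sup>2"
      using v t by (simp add: A_def field_simps)
    finally have quad: "L (F (a + d)) \<le> A * l\<^sup>2" .
    have "A * l\<^sup>2 \<le> (1 - c) * l"
      using mult_right_mono[OF l(3) l(1)] by (simp add: power2_eq_square mult.assoc)
    moreover have "0 \<le> c * v"
      using c t L_nonneg by (simp add: v_def prox_model_def)
    ultimately have "L (F (a + d)) - l \<le> c * (v - l)"
      using quad by (simp add: algebra_simps)
    \<comment> \<open>The power with exponent 0 passes the test and no step exceeds 1, so the full
      step is taken.\<close>
    then have "\<eta> = 1"
      using \<eta>(2,3) by (simp add: sufficient_decrease_def v_def l_def)
    then show ?thesis using \<eta>(1) nd quad by (simp add: a_def l_def)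
  qed
  then show ?thesis using \<delta> \<epsilon> A B by blast
qed

text \<open>The loss is the gauge in \<open>trapped_sequence\<close>, which gives a rate in the
  squared loss; as the limit value is 0, \<open>LF_lipschitz_at\<close> bounds the loss by the
  distance to \<open>\<theta>s\<close>.\<close>

theorem quadratic_convergence: "converges_quadratically \<theta> \<theta>s"
proof -
  obtain \<delta> \<epsilon> A B where pos: "\<delta> > 0" "\<epsilon> > 0" "A > 0" "B > 0"
    and loc: "\<And>k. \<theta> k \<in> ball \<theta>s \<delta> \<Longrightarrow> L (F (\<theta> k)) \<le> \<epsilon> \<Longrightarrow>
     norm (\<theta> (Suc k) - \<theta> k) \<le> B * L (F (\<theta> k)) \<and> L (F (\<theta> (Suc k))) \<le> A * (L (F (\<theta> k)))\<^sup>2"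
    using local_step by blast
  obtain r where r: "strict_mono r" "(\<theta> \<circ> r) \<longlonglongrightarrow> \<theta>s" "(\<lambda>n. L (F (\<theta> (r n)))) \<longlonglongrightarrow> 0"
    using cluster_seq unfolding LF_cluster_zero by metis
  then have r3: "((\<lambda>k. L (F (\<theta> k))) \<circ> r) \<longlonglongrightarrow> 0" by (simp add: o_def)
  obtain C where conv: "\<theta> \<longlonglongrightarrow> \<theta>s" and C: "C > 0"
    and rate: "\<forall>\<^sub>F k in sequentially. norm (\<theta> (Suc k) - \<theta>s) \<le> C * (L (F (\<theta> k)))\<^sup>2"
    using trapped_sequence[OF r(1,2) r3 L_nonneg pos loc] by blast
  obtain D where D: "D > 0" "\<And>b. b \<in> ball \<theta>s 1 \<Longrightarrow> \<bar>L (F b)\<bar> \<le> D * norm (b - \<theta>s)"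
    using LF_lipschitz_at unfolding LF_cluster_zero by auto
  have "\<forall>\<^sub>F k in sequentially. norm (\<theta> (Suc k) - \<theta>s) \<le> C * D\<^sup>2 * (norm (\<theta> k - \<theta>s))\<^sup>2"
    using rate tendstoD[OF conv zero_less_one]
  proof eventually_elim
    case (elim k)
    then have "L (F (\<theta> k)) \<le> D * norm (\<theta> k - \<theta>s)"
      using D(2)[of "\<theta> k"] by (simp add: dist_commute)
    then have "(L (F (\<theta> k)))\<^sup>2 \<le> D\<^sup>2 * (norm (\<theta> k - \<theta>s))\<^sup>2"
      using L_nonneg power_mono by (fastforce simp flip: power_mult_distrib)
    then show ?case
      using elim(1) C mult_left_mono[of "(L (F (\<theta> k)))\<^sup>2" "D\<^sup>2 * (norm (\<theta> k - \<theta>s))\<^sup>2" C]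
      by linarith
  qed
  then show ?thesis using conv C D unfolding converges_quadratically_def
    by (intro conjI exI[of _ "C * D\<^sup>2"]) auto
qed

lemma optimal: "\<theta>s \<in> argmin_set (\<lambda>\<theta>'. L (F \<theta>'))" "F \<theta>s \<in> argmin_set L"
  using L_nonneg by (auto simp: argmin_set_def is_arg_min_def LF_cluster_zero not_less)

end

section \<open>Quadratic Taylor remainder of the network\<close>

text \<open>Recording inequalities around linear maps \<open>D a\<close> gives closure under the
  network's operations without second derivatives. The Lipschitz clause serves products and
  compositions, where increments are multiplied or squared. \<open>D\<close> is chosen before
  \<open>R\<close>, so one family serves all balls.\<close>

definition quadratic_remainder :: "('a::real_normed_vector \<Rightarrow> real) \<Rightarrow> bool" where
  "quadratic_remainder f \<longleftrightarrow> (\<exists>D. (\<forall>a. bounded_linear (D a)) \<and>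
     (\<forall>R. \<exists>M\<ge>0. \<forall>a\<in>cball 0 R. \<forall>b\<in>cball 0 R.
        \<bar>f b - f a\<bar> \<le> M * norm (b - a) \<and> \<bar>f b - f a - D a (b - a)\<bar> \<le> M * (norm (b - a))\<^sup>2))"

lemma quadratic_remainderI:
  assumes "\<And>a. bounded_linear (D a)"
    and "\<And>R. \<exists>M\<ge>0. \<forall>a\<in>cball 0 R. \<forall>b\<in>cball 0 R.
        \<bar>f b - f a\<bar> \<le> M * norm (b - a) \<and> \<bar>f b - f a - D a (b - a)\<bar> \<le> M * (norm (b - a))\<^sup>2"
  shows "quadratic_remainder f"
  using assms unfolding quadratic_remainder_def by blast

lemma quadratic_remainder_const: "quadratic_remainder (\<lambda>_. k)"
  by (rule quadratic_remainderI[of "\<lambda>_ _. 0"]) auto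

lemma quadratic_remainder_linear:
  assumes "bounded_linear f"
  shows "quadratic_remainder f"
proof (rule quadratic_remainderI[of "\<lambda>_. f"])
  obtain K where K: "\<And>v. norm (f v) \<le> norm v * K" "K \<ge> 0"
    using bounded_linear.nonneg_bounded[OF assms] by blast
  have "f b - f a = f (b - a)" for a b
    using assms by (simp add: bounded_linear.linear linear_diff)
  then show "\<exists>M\<ge>0. \<forall>a\<in>cball 0 R. \<forall>b\<in>cball 0 R.
        \<bar>f b - f a\<bar> \<le> M * norm (b - a) \<and> \<bar>f b - f a - f (b - a)\<bar> \<le> M * (norm (b - a))\<^sup>2" for R
    using K by (intro exI[of _ K]) (auto simp: mult.commute)
qed (rule assms)

lemma quadratic_remainder_add:
  assumes "quadratic_remainder f" "quadratic_remainder g"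
  shows "quadratic_remainder (\<lambda>x. f x + g x)"
proof -
  obtain D where D: "\<And>a. bounded_linear (D a)"
    "\<And>R. \<exists>M\<ge>0. \<forall>a\<in>cball 0 R. \<forall>b\<in>cball 0 R.
        \<bar>f b - f a\<bar> \<le> M * norm (b - a) \<and> \<bar>f b - f a - D a (b - a)\<bar> \<le> M * (norm (b - a))\<^sup>2"
    using assms(1) unfolding quadratic_remainder_def by blast
  obtain E where E: "\<And>a. bounded_linear (E a)"
    "\<And>R. \<exists>M\<ge>0. \<forall>a\<in>cball 0 R. \<forall>b\<in>cball 0 R.
        \<bar>g b - g a\<bar> \<le> M * norm (b - a) \<and> \<bar>g b - g a - E a (b - a)\<bar> \<le> M * (norm (b - a))\<^sup>2"
    using assms(2) unfolding quadratic_remainder_def by blast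
  show ?thesis
  proof (rule quadratic_remainderI[of "\<lambda>a h. D a h + E a h"])
    fix R
    obtain M where M: "M \<ge> 0" "\<And>a b. a \<in> cball 0 R \<Longrightarrow> b \<in> cball 0 R \<Longrightarrow>
      \<bar>f b - f a\<bar> \<le> M * norm (b - a) \<and> \<bar>f b - f a - D a (b - a)\<bar> \<le> M * (norm (b - a))\<^sup>2"
      using D(2)[of R] by blast
    obtain N where N: "N \<ge> 0" "\<And>a b. a \<in> cball 0 R \<Longrightarrow> b \<in> cball 0 R \<Longrightarrow>
      \<bar>g b - g a\<bar> \<le> N * norm (b - a) \<and> \<bar>g b - g a - E a (b - a)\<bar> \<le> N * (norm (b - a))\<^sup>2"
      using E(2)[of R] by blast
    show "\<exists>M\<ge>0. \<forall>a\<in>cball 0 R. \<forall>b\<in>cball 0 R.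
        \<bar>f b + g b - (f a + g a)\<bar> \<le> M * norm (b - a) \<and>
        \<bar>f b + g b - (f a + g a) - (D a (b - a) + E a (b - a))\<bar> \<le> M * (norm (b - a))\<^sup>2"
    proof (intro exI[of _ "M + N"] conjI ballI)
      fix a b :: 'a assume ab: "a \<in> cball 0 R" "b \<in> cball 0 R"
      show "\<bar>f b + g b - (f a + g a)\<bar> \<le> (M + N) * norm (b - a)"
        unfolding distrib_right using M(2)[OF ab] N(2)[OF ab] by linarith
      show "\<bar>f b + g b - (f a + g a) - (D a (b - a) + E a (b - a))\<bar> \<le> (M + N) * (norm (b - a))\<^sup>2"
        unfolding distrib_right using M(2)[OF ab] N(2)[OF ab] by linarith
    qed (use M N in auto)
  qed (intro bounded_linear_add D E)
qed

text \<open>The error of the product rule splits into two weighted remainders and the product of the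
  two increments, each quadratic on a ball where \<open>f\<close> and \<open>g\<close> are
  bounded.\<close>

lemma quadratic_remainder_mult:
  assumes "quadratic_remainder f" "quadratic_remainder g"
  shows "quadratic_remainder (\<lambda>x. f x * g x)"
proof -
  obtain D where D: "\<And>a. bounded_linear (D a)"
    "\<And>R. \<exists>M\<ge>0. \<forall>a\<in>cball 0 R. \<forall>b\<in>cball 0 R.
        \<bar>f b - f a\<bar> \<le> M * norm (b - a) \<and> \<bar>f b - f a - D a (b - a)\<bar> \<le> M * (norm (b - a))\<^sup>2"
    using assms(1) unfolding quadratic_remainder_def by blast
  obtain E where E: "\<And>a. bounded_linear (E a)"
    "\<And>R. \<exists>M\<ge>0. \<forall>a\<in>cball 0 R. \<forall>b\<in>cball 0 R.
        \<bar>g b - g a\<bar> \<le> M * norm (b - a) \<and> \<bar>g b - g a - E a (b - a)\<bar> \<le> M * (norm (b - a))\<^sup>2"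
    using assms(2) unfolding quadratic_remainder_def by blast
  show ?thesis
  proof (rule quadratic_remainderI[of "\<lambda>a h. f a * E a h + g a * D a h"])
    fix R
    obtain M where M: "M \<ge> 0" "\<And>a b. a \<in> cball 0 R \<Longrightarrow> b \<in> cball 0 R \<Longrightarrow>
      \<bar>f b - f a\<bar> \<le> M * norm (b - a) \<and> \<bar>f b - f a - D a (b - a)\<bar> \<le> M * (norm (b - a))\<^sup>2"
      using D(2)[of R] by blast
    obtain N where N: "N \<ge> 0" "\<And>a b. a \<in> cball 0 R \<Longrightarrow> b \<in> cball 0 R \<Longrightarrow>
      \<bar>g b - g a\<bar> \<le> N * norm (b - a) \<and> \<bar>g b - g a - E a (b - a)\<bar> \<le> N * (norm (b - a))\<^sup>2"
      using E(2)[of R] by blast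
    \<comment> \<open>A bound for \<open>f\<close> from its value at the origin and its Lipschitz
      constant; \<open>\<bar>R\<bar>\<close> keeps it nonnegative for negative radii, whose balls
      are empty.\<close>
    define P where "P = \<bar>f 0\<bar> + M * \<bar>R\<bar>"
    define Q where "Q = \<bar>g 0\<bar> + N * \<bar>R\<bar>"
    have P: "\<bar>f a\<bar> \<le> P" and Q: "\<bar>g a\<bar> \<le> Q" if "a \<in> cball 0 R" for a
    proof -
      have "norm a \<le> R" using that by simp
      then have a: "norm a \<le> \<bar>R\<bar>" "(0::'a) \<in> cball 0 R"
        using norm_ge_zero[of a] unfolding mem_cball_0 norm_zero by linarith+
      then have "M * norm a \<le> M * \<bar>R\<bar>" "N * norm a \<le> N * \<bar>R\<bar>"
        using M(1) N(1) by (auto intro: mult_left_mono)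
      then show "\<bar>f a\<bar> \<le> P" "\<bar>g a\<bar> \<le> Q"
        using M(2)[OF a(2) that] N(2)[OF a(2) that] by (auto simp: P_def Q_def)
    qed
    show "\<exists>M\<ge>0. \<forall>a\<in>cball 0 R. \<forall>b\<in>cball 0 R.
        \<bar>f b * g b - f a * g a\<bar> \<le> M * norm (b - a) \<and>
        \<bar>f b * g b - f a * g a - (f a * E a (b - a) + g a * D a (b - a))\<bar> \<le> M * (norm (b - a))\<^sup>2"
    proof (intro exI[of _ "P * N + Q * M + M * N"] conjI ballI)
      have PQ: "0 \<le> P" "0 \<le> Q" using M N by (auto simp: P_def Q_def)
      then show "0 \<le> P * N + Q * M + M * N" using M N by simp
      fix a b :: 'a assume ab: "a \<in> cball 0 R" "b \<in> cball 0 R"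
      define e where "e = norm (b - a)"
      have e: "e \<ge> 0" by (simp add: e_def)
      have m: "\<bar>f b - f a\<bar> \<le> M * e" "\<bar>f b - f a - D a (b - a)\<bar> \<le> M * e\<^sup>2"
        "\<bar>g b - g a\<bar> \<le> N * e" "\<bar>g b - g a - E a (b - a)\<bar> \<le> N * e\<^sup>2"
        using M(2)[OF ab] N(2)[OF ab] by (auto simp: e_def)
      have "\<bar>f b * g b - f a * g a\<bar> = \<bar>f b * (g b - g a) + g a * (f b - f a)\<bar>"
        by (simp add: algebra_simps)
      also have "\<dots> \<le> \<bar>f b\<bar> * \<bar>g b - g a\<bar> + \<bar>g a\<bar> * \<bar>f b - f a\<bar>"
        by (metis abs_mult abs_triangle_ineq)
      also have "\<dots> \<le> P * (N * e) + Q * (M * e)"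
        using m PQ P[OF ab(2)] Q[OF ab(1)] by (intro add_mono mult_mono) auto
      also have "\<dots> \<le> (P * N + Q * M + M * N) * e"
        using M N e by (simp add: algebra_simps)
      finally show "\<bar>f b * g b - f a * g a\<bar> \<le> (P * N + Q * M + M * N) * norm (b - a)"
        by (simp add: e_def)
      have "\<bar>f b * g b - f a * g a - (f a * E a (b - a) + g a * D a (b - a))\<bar> =
        \<bar>f a * (g b - g a - E a (b - a)) + g a * (f b - f a - D a (b - a)) + (f b - f a) * (g b - g a)\<bar>"
        by (simp add: algebra_simps)
      also have "\<dots> \<le> \<bar>f a * (g b - g a - E a (b - a))\<bar> + \<bar>g a * (f b - f a - D a (b - a))\<bar>
          + \<bar>(f b - f a) * (g b - g a)\<bar>"
        by linarith
      also have "\<dots> \<le> P * (N * e\<^sup>2) + Q * (M * e\<^sup>2) + (M * e) * (N * e)"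
        unfolding abs_mult using m PQ P[OF ab(1)] Q[OF ab(1)] M N e
        by (intro add_mono mult_mono) auto
      also have "\<dots> = (P * N + Q * M + M * N) * e\<^sup>2"
        by (simp add: algebra_simps power2_eq_square)
      finally show "\<bar>f b * g b - f a * g a - (f a * E a (b - a) + g a * D a (b - a))\<bar>
          \<le> (P * N + Q * M + M * N) * (norm (b - a))\<^sup>2"
        by (simp add: e_def)
    qed
  qed (intro bounded_linear_add bounded_linear_const_mult D E)
qed

lemma quadratic_remainder_sum:
  assumes "\<And>i. i \<in> I \<Longrightarrow> quadratic_remainder (f i)"
  shows "quadratic_remainder (\<lambda>x. \<Sum>i\<in>I. f i x)"
  using assms
  by (induction I rule: infinite_finite_induct)
    (auto intro: quadratic_remainder_add quadratic_remainder_const)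

section \<open>Estimates for the sigmoid\<close>

lemma sigmoid_bounds: "0 < sigmoid a" "sigmoid a < 1"
  by (auto simp: sigmoid_def add_pos_pos divide_simps intro: add_strict_increasing)

lemma sigmoid_deriv: "(sigmoid has_real_derivative sigmoid a * (1 - sigmoid a)) (at a within S)"
proof -
  have "1 + exp (- a) \<noteq> 0" using exp_gt_zero[of "- a"] by linarith
  then show ?thesis
    unfolding sigmoid_def
    by (auto intro!: derivative_eq_intros simp: field_simps power2_eq_square)
qed

lemma sigmoid_lipschitz: "\<bar>sigmoid b - sigmoid a\<bar> \<le> \<bar>b - a\<bar>"
proof -
  have "norm (sigmoid b - sigmoid a) \<le> 1 * norm (b - a)"
  proof (rule field_differentiable_bound)
    show "norm (sigmoid z * (1 - sigmoid z)) \<le> 1" for z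
      using sigmoid_bounds[of z] by (simp add: abs_mult mult_le_one)
    show "(sigmoid has_real_derivative sigmoid z * (1 - sigmoid z)) (at z within UNIV)" for z
      by (rule sigmoid_deriv)
  qed auto
  then show ?thesis by simp
qed

text \<open>With \<open>s\<close> the slope at \<open>a\<close>, the derivative of
  \<open>sigmoid z - s * z\<close> is at most \<open>\<bar>b - a\<bar>\<close> in absolute value on
  the segment, and the mean value inequality supplies the second factor.\<close>

lemma sigmoid_remainder:
  "\<bar>sigmoid b - sigmoid a - sigmoid a * (1 - sigmoid a) * (b - a)\<bar> \<le> \<bar>b - a\<bar>\<^sup>2"
proof -
  define s where "s = sigmoid a * (1 - sigmoid a)"
  define S where "S = closed_segment a b"
  have "norm ((sigmoid b - s * b) - (sigmoid a - s * a)) \<le> \<bar>b - a\<bar> * norm (b - a)"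
  proof (rule field_differentiable_bound)
    show "((\<lambda>z. sigmoid z - s * z) has_real_derivative sigmoid z * (1 - sigmoid z) - s) (at z within S)"
      for z
      by (auto intro!: derivative_eq_intros sigmoid_deriv)
    show "norm (sigmoid z * (1 - sigmoid z) - s) \<le> \<bar>b - a\<bar>" if "z \<in> S" for z
    proof -
      \<comment> \<open>The slope is \<open>u * (1 - u)\<close> in terms of the value
        \<open>u\<close>, so a difference of slopes factors as \<open>(u - w) * (1 - u - w)\<close>;
        the second factor has absolute value at most 1.\<close>
      have "\<bar>sigmoid z * (1 - sigmoid z) - s\<bar> = \<bar>sigmoid z - sigmoid a\<bar> * \<bar>1 - sigmoid z - sigmoid a\<bar>"
        by (simp add: s_def algebra_simps flip: abs_mult)
      also have "\<dots> \<le> \<bar>sigmoid z - sigmoid a\<bar>"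
        using sigmoid_bounds[of z] sigmoid_bounds[of a] by (intro mult_left_le) auto
      also have "\<dots> \<le> \<bar>z - a\<bar>" by (rule sigmoid_lipschitz)
      also have "\<dots> \<le> \<bar>b - a\<bar>"
        using segment_bound(1)[of z a b] that by (simp add: S_def)
      finally show ?thesis by simp
    qed
  qed (auto simp: S_def)
  then show ?thesis by (simp add: s_def algebra_simps power2_eq_square)
qed

text \<open>The chain rule error is the sigmoid's own remainder at \<open>f a\<close>, quadratic in
  the increment of \<open>f\<close>, plus the remainder of \<open>f\<close> times a slope at most 1;
  this explains the constant \<open>M + M\<^sup>2\<close>.\<close>

lemma quadratic_remainder_sigmoid:
  assumes "quadratic_remainder f"
  shows "quadratic_remainder (\<lambda>x. sigmoid (f x))"
proof -
  obtain D where D: "\<And>a. bounded_linear (D a)"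
    "\<And>R. \<exists>M\<ge>0. \<forall>a\<in>cball 0 R. \<forall>b\<in>cball 0 R.
        \<bar>f b - f a\<bar> \<le> M * norm (b - a) \<and> \<bar>f b - f a - D a (b - a)\<bar> \<le> M * (norm (b - a))\<^sup>2"
    using assms(1) unfolding quadratic_remainder_def by blast
  define s where "s a = sigmoid (f a) * (1 - sigmoid (f a))" for a
  have s: "\<bar>s a\<bar> \<le> 1" for a
    using sigmoid_bounds[of "f a"] by (simp add: s_def abs_mult mult_le_one)
  show ?thesis
  proof (rule quadratic_remainderI[of "\<lambda>a h. s a * D a h"])
    fix R
    obtain M where M: "M \<ge> 0" "\<And>a b. a \<in> cball 0 R \<Longrightarrow> b \<in> cball 0 R \<Longrightarrow>
      \<bar>f b - f a\<bar> \<le> M * norm (b - a) \<and> \<bar>f b - f a - D a (b - a)\<bar> \<le> M * (norm (b - a))\<^sup>2"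
      using D(2)[of R] by blast
    show "\<exists>M\<ge>0. \<forall>a\<in>cball 0 R. \<forall>b\<in>cball 0 R.
        \<bar>sigmoid (f b) - sigmoid (f a)\<bar> \<le> M * norm (b - a) \<and>
        \<bar>sigmoid (f b) - sigmoid (f a) - s a * D a (b - a)\<bar> \<le> M * (norm (b - a))\<^sup>2"
    proof (intro exI[of _ "M + M\<^sup>2"] conjI ballI)
      show "0 \<le> M + M\<^sup>2" using M by simp
      fix a b :: 'a assume ab: "a \<in> cball 0 R" "b \<in> cball 0 R"
      define e where "e = norm (b - a)"
      have m: "\<bar>f b - f a\<bar> \<le> M * e" "\<bar>f b - f a - D a (b - a)\<bar> \<le> M * e\<^sup>2"
        using M(2)[OF ab] by (auto simp: e_def)
      have "\<bar>sigmoid (f b) - sigmoid (f a)\<bar> \<le> M * e"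
        using sigmoid_lipschitz[of "f b" "f a"] m by linarith
      also have "\<dots> \<le> (M + M\<^sup>2) * e"
        by (intro mult_right_mono) (auto simp: e_def)
      finally show "\<bar>sigmoid (f b) - sigmoid (f a)\<bar> \<le> (M + M\<^sup>2) * norm (b - a)"
        by (simp add: e_def)
      have "\<bar>sigmoid (f b) - sigmoid (f a) - s a * (f b - f a)\<bar> \<le> \<bar>f b - f a\<bar>\<^sup>2"
        unfolding s_def by (rule sigmoid_remainder)
      also have "\<dots> \<le> (M * e)\<^sup>2"
        using m by (intro power_mono) auto
      finally have 1: "\<bar>sigmoid (f b) - sigmoid (f a) - s a * (f b - f a)\<bar> \<le> M\<^sup>2 * e\<^sup>2"
        by (simp add: power_mult_distrib)
      have 2: "\<bar>s a * (f b - f a - D a (b - a))\<bar> \<le> 1 * (M * e\<^sup>2)"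
        unfolding abs_mult using m s[of a] by (intro mult_mono) auto
      have "sigmoid (f b) - sigmoid (f a) - s a * D a (b - a) =
        (sigmoid (f b) - sigmoid (f a) - s a * (f b - f a)) + s a * (f b - f a - D a (b - a))"
        by (simp add: algebra_simps)
      also have "\<bar>\<dots>\<bar> \<le> (M + M\<^sup>2) * e\<^sup>2"
        unfolding distrib_right using 1 2 by linarith
      finally show "\<bar>sigmoid (f b) - sigmoid (f a) - s a * D a (b - a)\<bar> \<le> (M + M\<^sup>2) * (norm (b - a))\<^sup>2"
        by (simp add: e_def)
    qed
  qed (intro bounded_linear_const_mult D)
qed

text \<open>Expanded in coordinates, the network arises from coordinate projections and constants by
  sums, products and the sigmoid.\<close>

lemma quadratic_remainder_network: "quadratic_remainder (\<lambda>\<theta>. network \<theta> x)"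
  unfolding network_def inner_vec_def inner_real_def vec_lambda_beta
  by (intro quadratic_remainder_add quadratic_remainder_sum quadratic_remainder_mult
      quadratic_remainder_sigmoid quadratic_remainder_const
      quadratic_remainder_linear[OF bounded_linear_vec_nth])

text \<open>The componentwise linear maps assemble to one with quadratic error; this makes it the
  derivative, and uniqueness identifies it with the Jacobian.\<close>

lemma Jac_remainder:
  fixes F :: "real ^ 'n::finite \<Rightarrow> real ^ 'm::finite"
  assumes "\<And>i. quadratic_remainder (\<lambda>a. F a $ i)"
  shows "\<exists>M>0. \<forall>a\<in>cball 0 R. \<forall>b\<in>cball 0 R.
    norm (F b - F a - Jac F a *v (b - a)) \<le> M * (norm (b - a))\<^sup>2"
proof -
  obtain D where D: "\<And>i a. bounded_linear (D i a)"
    "\<And>i R. \<exists>M\<ge>0. \<forall>a\<in>cball 0 R. \<forall>b\<in>cball 0 R.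
        \<bar>F b $ i - F a $ i\<bar> \<le> M * norm (b - a) \<and> \<bar>F b $ i - F a $ i - D i a (b - a)\<bar> \<le> M * (norm (b - a))\<^sup>2"
    using assms unfolding quadratic_remainder_def by metis
  define G where "G a h = (\<chi> i. D i a h)" for a h
  have G: "\<exists>M>0. \<forall>a\<in>cball 0 R. \<forall>b\<in>cball 0 R. norm (F b - F a - G a (b - a)) \<le> M * (norm (b - a))\<^sup>2"
    for R
  proof -
    obtain M where M: "\<And>i. M i \<ge> 0" "\<And>i a b. a \<in> cball 0 R \<Longrightarrow> b \<in> cball 0 R \<Longrightarrow>
        \<bar>F b $ i - F a $ i - D i a (b - a)\<bar> \<le> M i * (norm (b - a))\<^sup>2"
      using D(2)[of R] by metis
    have "norm (F b - F a - G a (b - a)) \<le> (1 + sum M UNIV) * (norm (b - a))\<^sup>2"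
      if "a \<in> cball 0 R" "b \<in> cball 0 R" for a b
    proof -
      have "norm (F b - F a - G a (b - a)) \<le> (\<Sum>i\<in>UNIV. \<bar>F b $ i - F a $ i - D i a (b - a)\<bar>)"
        using norm_le_l1_cart[of "F b - F a - G a (b - a)"] by (simp add: G_def)
      also have "\<dots> \<le> (\<Sum>i\<in>UNIV. M i * (norm (b - a))\<^sup>2)"
        using M(2) that by (intro sum_mono) auto
      also have "\<dots> \<le> (1 + sum M UNIV) * (norm (b - a))\<^sup>2"
        by (simp add: sum_distrib_right distrib_right)
      finally show ?thesis .
    qed
    then show ?thesis
      using add_pos_nonneg[OF zero_less_one sum_nonneg[of UNIV M]] M(1) by blast
  qed
  have "(F has_derivative G a) (at a)" for a
    unfolding has_derivative_iff_norm
  proof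
    have "linear (G a)"
      using D(1)[THEN bounded_linear.linear]
      by (auto intro!: linearI simp: G_def vec_eq_iff linear_add linear_scale)
    then show "bounded_linear (G a)" by (simp add: linear_linear)
    obtain M where M: "\<And>b c. b \<in> cball 0 (norm a + 1) \<Longrightarrow> c \<in> cball 0 (norm a + 1) \<Longrightarrow>
        norm (F c - F b - G b (c - b)) \<le> M * (norm (c - b))\<^sup>2"
      using G[of "norm a + 1"] by blast
    show "((\<lambda>y. norm (F y - F a - G a (y - a)) / norm (y - a)) \<longlongrightarrow> 0) (at a)"
    proof (rule tendsto_0_le[where K = M])
      show "((\<lambda>y. norm (y - a)) \<longlongrightarrow> 0) (at a)"
        by (auto intro!: tendsto_eq_intros)
      have "\<forall>\<^sub>F y in at a. dist y a < 1"
        by (auto simp: eventually_at intro: exI[of _ 1])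
      then show "\<forall>\<^sub>F y in at a. norm (norm (F y - F a - G a (y - a)) / norm (y - a)) \<le> norm (norm (y - a)) * M"
      proof eventually_elim
        case (elim y)
        have "norm y \<le> norm a + 1"
          using elim norm_triangle_ineq[of a "y - a"] by (simp add: dist_norm)
        then have "norm (F y - F a - G a (y - a)) \<le> M * (norm (y - a))\<^sup>2"
          by (intro M) auto
        then show ?case
          by (cases "y = a") (auto simp: field_simps power2_eq_square)
      qed
    qed
  qed
  then have "Jac F a *v h = G a h" for a h
    by (metis jacobian_works differentiableI has_derivative_unique)
  then show ?thesis using G by simp
qed

section \<open>The absolute and hinge losses\<close>

text \<open>\<open>\<phi>\<close> is the distance to its zero set, and \<open>\<pi> s\<close> is a zero nearest to \<open>s\<close>.\<close>

locale mean_loss =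
  fixes \<phi> \<pi> :: "real \<Rightarrow> real"
  assumes \<phi>_convex: "convex_on UNIV \<phi>"
    and \<phi>_lipschitz: "\<bar>\<phi> s - \<phi> r\<bar> \<le> \<bar>s - r\<bar>"
    and \<phi>_zero: "\<phi> (\<pi> s) = 0" and \<phi>_dist: "\<phi> s = \<bar>\<pi> s - s\<bar>"
begin

definition loss :: "real ^ 'm::finite \<Rightarrow> real" where
  "loss z = 1 / real CARD('m) * (\<Sum>i\<in>UNIV. \<phi> (z $ i))"

lemma loss_convex: "convex_on UNIV loss"
proof (rule convex_onI)
  fix s :: real and u v :: "real ^ 'm::finite"
  assume s: "0 < s" "s < 1"
  have "(\<Sum>i\<in>UNIV. \<phi> (((1 - s) *\<^sub>R u + s *\<^sub>R v) $ i)) \<le> (\<Sum>i\<in>UNIV. (1 - s) * \<phi> (u $ i) + s * \<phi> (v $ i))"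
    using convex_onD[OF \<phi>_convex, of s] s by (intro sum_mono) simp
  also have "\<dots> = (1 - s) * (\<Sum>i\<in>UNIV. \<phi> (u $ i)) + s * (\<Sum>i\<in>UNIV. \<phi> (v $ i))"
    by (simp add: sum.distrib sum_distrib_left)
  finally show "loss ((1 - s) *\<^sub>R u + s *\<^sub>R v) \<le> (1 - s) * loss u + s * loss v"
    by (simp add: loss_def divide_right_mono flip: add_divide_distrib)
qed simp

lemma loss_lipschitz: "\<bar>loss u - loss v\<bar> \<le> norm (u - v)"
  for u v :: "real ^ 'm::finite"
proof -
  have "\<bar>(\<Sum>i\<in>UNIV. \<phi> (u $ i)) - (\<Sum>i\<in>UNIV. \<phi> (v $ i))\<bar> \<le> (\<Sum>i\<in>UNIV. \<bar>\<phi> (u $ i) - \<phi> (v $ i)\<bar>)"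
    by (simp add: sum_abs flip: sum_subtractf)
  also have "\<dots> \<le> (\<Sum>i\<in>(UNIV :: 'm set). norm (u - v))"
    using \<phi>_lipschitz component_le_norm_cart[of "u - v"]
    by (intro sum_mono) (metis order_trans vector_minus_component)
  finally show ?thesis
    by (simp add: loss_def field_simps flip: diff_divide_distrib)
qed

lemma loss_nonneg: "0 \<le> loss z"
  by (simp add: loss_def \<phi>_dist[of "_ $ _"] sum_nonneg)

text \<open>Moving each coordinate to a nearest zero of \<open>\<phi>\<close> gives a displacement
  whose 1-norm is the sum of the \<open>\<phi>\<close> values; the cardinality undoes the
  averaging.\<close>

lemma loss_sharp: "\<exists>p. loss p = 0 \<and> norm (p - z) \<le> real CARD('m) * loss z"
  for z :: "real ^ 'm::finite"
proof (intro exI[of _ "\<chi> i. \<pi> (z $ i)"] conjI)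
  show "loss (\<chi> i. \<pi> (z $ i)) = 0" by (simp add: loss_def \<phi>_zero)
  show "norm ((\<chi> i. \<pi> (z $ i)) - z) \<le> real CARD('m) * loss z"
    using norm_le_l1_cart[of "(\<chi> i. \<pi> (z $ i)) - z"] by (simp add: loss_def \<phi>_dist)
qed

end

section \<open>The two losses as instances, and the sigmoid network problem\<close>

interpretation abs: mean_loss abs "\<lambda>_. 0"
proof
  show "convex_on UNIV (abs :: real \<Rightarrow> real)"
    using convex_on_dist[of UNIV "0 :: real"] by (simp add: dist_norm)
qed auto

text \<open>The zero set is the half-line from 1 on, and \<open>max s 1\<close> projects onto
  it.\<close>

interpretation hinge: mean_loss "\<lambda>s. max (1 - s) 0" "\<lambda>s. max s 1"
proof
  show "convex_on UNIV (\<lambda>s::real. max (1 - s) 0)"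
  proof (rule convex_onI)
    fix t x y :: real assume t: "0 < t" "t < 1"
    have "0 \<le> (1 - t) * (max (1 - x) 0 - (1 - x))" "0 \<le> t * (max (1 - y) 0 - (1 - y))"
      "0 \<le> (1 - t) * max (1 - x) 0" "0 \<le> t * max (1 - y) 0"
      using t by auto
    then show "max (1 - ((1 - t) *\<^sub>R x + t *\<^sub>R y)) 0 \<le> (1 - t) * max (1 - x) 0 + t * max (1 - y) 0"
      by (intro max.boundedI) (simp_all add: algebra_simps)
  qed simp
qed auto

lemma abs_outer_eq: "abs_outer = abs.loss"
  by (simp add: fun_eq_iff abs_outer_def abs.loss_def)

lemma hinge_outer_eq: "hinge_outer = hinge.loss"
  by (simp add: fun_eq_iff hinge_outer_def hinge.loss_def)

theorem corollary6:
  fixes x :: "'m::finite \<Rightarrow> real ^ 'd::finite"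
    and y :: "'m \<Rightarrow> real"
    and F :: "real ^ ('q::finite, 'd) param \<Rightarrow> real ^ 'm"
    and L :: "real ^ 'm \<Rightarrow> real"
    and t c \<tau> :: real
    and \<theta> :: "nat \<Rightarrow> real ^ ('q, 'd) param"
    and \<theta>s :: "real ^ ('q, 'd) param"
  assumes loss: "F = abs_inner x y \<and> L = abs_outer \<or> F = hinge_inner x y \<and> L = hinge_outer"
    and t: "t > 0"
    and c: "0 < c" "c < 1"
    and \<tau>: "0 < \<tau>" "\<tau> < 1"
    and glpa: "GLPA_sequence L F t c \<tau> \<theta>"
    and cluster: "cluster_point \<theta> \<theta>s"
    and full_rank: "rank (Jac F \<theta>s) = CARD('m)"
  shows "converges_quadratically \<theta> \<theta>s \<and>
         \<theta>s \<in> argmin_set (\<lambda>\<theta>'. L (F \<theta>')) \<and>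
         F \<theta>s \<in> argmin_set L"
proof -
  \<comment> \<open>Relative to the network, the absolute loss adds a constant and the hinge loss
    multiplies by one.\<close>
  have F: "quadratic_remainder (\<lambda>a. F a $ i)" for i
    using loss unfolding abs_inner_def[abs_def] hinge_inner_def[abs_def]
    by (auto simp only: diff_conv_add_uminus vec_lambda_beta intro!: quadratic_remainder_add quadratic_remainder_mult quadratic_remainder_const
        quadratic_remainder_network)
  have L: "convex_on UNIV L" "\<bar>L u - L v\<bar> \<le> 1 * norm (u - v)" "0 \<le> L z"
    "\<exists>p. L p = 0 \<and> norm (p - z) \<le> real CARD('m) * L z" for u v z
    using loss abs.loss_convex abs.loss_lipschitz abs.loss_nonneg abs.loss_sharp
      hinge.loss_convex hinge.loss_lipschitz hinge.loss_nonneg hinge.loss_sharp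
    by (auto simp: abs_outer_eq hinge_outer_eq)
  interpret glpa L F 1 "real CARD('m)" t c \<tau> \<theta> \<theta>s
    by unfold_locales (use L Jac_remainder[OF F] t c \<tau> glpa cluster full_rank in auto)
  show ?thesis using quadratic_convergence optimal by blast
qed

end
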